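(* Let $k\ge 2$ be an integer. Then the solutions $X$ to the equation $T_2(X)=kP_2$ are exactly the graphs $X=pP_4\cup qCP_{2n}$ for all integers $p\ge 0$, $q\ge 0$, and $n\ge 2$ that satisfy the Diophantine equation $2p+qn=k$.
   Context: All graphs are finite and simple, but not necessarily connected; equality of graphs means graph isomorphism. The $2$-distance graph $T_2(X)$ of a graph $X$ is the graph with vertex set $V(X)$ in which $u,v$ are adjacent if and only if their distance in $X$ (length of a shortest $u$-$v$ path, $\infty$ if they lie in different components) is exactly $2$. A graph $X$ is a solution to $T_2(X)=G$ if $T_2(X)$ is isomorphic to $G$. $P_r$ denotes the path of order $r$ (with $r$ vertices); $\cup$ denotes disjoint union, and $kH$ is the disjoint union of $k$ copies of a graph $H$. For $n\ge 2$, the cocktail party graph $CP_{2n}$ of order $2n$ is the graph with vertex set $\{u_1,\ldots,u_n,v_1,\ldots,v_n\}$ obtained from the complete graph $K_{2n}$ on these vertices by deleting the edges $u_iv_i$, $i=1,\ldots,n$.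
   Formalization: The value of n may differ between cocktail party components: X is pP_4 together with q_n copies of CP_{2n} for finitely many n≥2, where 2p plus the sum of q_n·n equals k. With a single n the claim fails: for k=5, X = CP_4 ∪ CP_6 is a solution. *)

theory Defs
  imports "Graph_Theory.Graph_Theory"
begin

(* A finite simple graph is a pair_pre_digraph satisfying pair_graph: an edge uv is stored as the
   two arcs (u,v) and (v,u).  The graph without vertices is allowed.  On such graphs digraph_iso
   is ordinary graph isomorphism. *)

(* Weight 1 on every arc turns the infimum of walk costs into the number of edges of a shortest
   path; it is infinity if v is not reachable from u. *)
definition gdist :: "'a pair_pre_digraph \<Rightarrow> 'a \<Rightarrow> 'a \<Rightarrow> ereal" where
  "gdist X u v = wf_digraph.\<mu> (with_proj X) (\<lambda>_. 1) u v"

definition T2 :: "'a pair_pre_digraph \<Rightarrow> 'a pair_pre_digraph" where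
  "T2 X = \<lparr> pverts = pverts X,
            parcs = {(u, v). u \<in> pverts X \<and> v \<in> pverts X \<and> gdist X u v = 2} \<rparr>"

definition path_graph :: "nat \<Rightarrow> nat pair_pre_digraph" where
  "path_graph r = \<lparr> pverts = {1..r},
                    parcs = {(i, j). i \<in> {1..r} \<and> j \<in> {1..r} \<and> (j = i + 1 \<or> i = j + 1)} \<rparr>"

(* CP_{2n}, with u_i = Inl i and v_i = Inr i. *)
definition cocktail_party :: "nat \<Rightarrow> (nat + nat) pair_pre_digraph" where
  "cocktail_party n =
     (let V = Inl ` {1..n} \<union> Inr ` {1..n}
      in \<lparr> pverts = V,
           parcs = {(x, y). x \<in> V \<and> y \<in> V \<and> x \<noteq> y}
                   - (\<Union>i\<in>{1..n}. {(Inl i, Inr i), (Inr i, Inl i)}) \<rparr>)"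

(* Disjoint unions are made disjoint by tagging the vertices. *)
definition disj_union ::
    "'a pair_pre_digraph \<Rightarrow> 'b pair_pre_digraph \<Rightarrow> ('a + 'b) pair_pre_digraph" where
  "disj_union G H = \<lparr> pverts = Inl ` pverts G \<union> Inr ` pverts H,
                      parcs = {(Inl u, Inl v) | u v. (u, v) \<in> parcs G}
                              \<union> {(Inr u, Inr v) | u v. (u, v) \<in> parcs H} \<rparr>"

definition disj_Union ::
    "'i set \<Rightarrow> ('i \<Rightarrow> 'a pair_pre_digraph) \<Rightarrow> ('i \<times> 'a) pair_pre_digraph" where
  "disj_Union I G = \<lparr> pverts = (SIGMA i:I. pverts (G i)),
                      parcs = {((i, u), (i, v)) | i u v. i \<in> I \<and> (u, v) \<in> parcs (G i)} \<rparr>"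

definition copies :: "nat \<Rightarrow> 'a pair_pre_digraph \<Rightarrow> (nat \<times> 'a) pair_pre_digraph" where
  "copies k H = disj_Union {1..k} (\<lambda>_. H)"

end

theory Submission
  imports Defs
begin

text \<open>
  The graph \<open>k P\<^sub>2\<close> is, up to isomorphism, the only perfect matching on \<open>2 k\<close> vertices, so
  \<open>X\<close> is a solution if and only if it has \<open>2 k\<close> vertices and each vertex \<open>v\<close> has exactly one
  vertex at distance \<open>2\<close>, called the partner of \<open>v\<close> below. This property of the 2-distance graph
  (\<open>one_regular\<close>) is invariant under isomorphism and can be checked on each member of a disjoint
  union, because vertices in different members have no common neighbour. Both \<open>P\<^sub>4\<close> and the
  cocktail party graphs of order at least \<open>4\<close> have it, and counting vertices gives the
  Diophantine equation.

  Conversely, let every vertex have exactly one partner. Suppose first that some path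
  \<open>a - b - c - d\<close> joins two vertices at distance \<open>3\<close>. Then \<open>a, c\<close> are partners and \<open>b, d\<close> are
  partners. A further neighbour \<open>e\<close> of \<open>a\<close> would have a walk of length \<open>2\<close> to \<open>b\<close>, and as the
  partner of \<open>b\<close> is already \<open>d\<close>, it would be adjacent to \<open>b\<close>; in the same way to \<open>c\<close> and then
  to \<open>d\<close>, so that \<open>a\<close> and \<open>d\<close> would be at distance \<open>2\<close>. A further neighbour of \<open>b\<close> would be
  adjacent to \<open>a\<close> as well, because the partner of \<open>a\<close> is \<open>c\<close>. By symmetry the path is an entire
  component (\<open>geodesic_component\<close>). If on the other hand no two vertices are at distance \<open>3\<close>,
  then every component has diameter \<open>2\<close>: each vertex is adjacent to all others of its component
  except for its partner, and the component is a cocktail party graph (\<open>ex_component\<close>). Splitting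
  off one component at a time gives the classification (\<open>decomposition\<close>).
\<close>

abbreviation pair_iso :: "'a pair_pre_digraph \<Rightarrow> 'b pair_pre_digraph \<Rightarrow> bool"
    (infix "\<simeq>" 50) where
  "G \<simeq> H \<equiv> digraph_iso (with_proj G) (with_proj H)"

section \<open>Isomorphisms as vertex bijections\<close>

text \<open>
  A digraph isomorphism also carries a bijection between the arcs and the two end maps of the
  image. Here an arc is the pair of its ends, so all of this is determined by the vertex map.
\<close>

lemma pair_isoI:
  assumes wfG: "pair_wf_digraph G" and wfH: "pair_wf_digraph H"
    and bij: "bij_betw f (pverts G) (pverts H)"
    and arcs: "\<And>u v. u \<in> pverts G \<Longrightarrow> v \<in> pverts G \<Longrightarrow>
      (u, v) \<in> parcs G \<longleftrightarrow> (f u, f v) \<in> parcs H"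
  shows "G \<simeq> H"
proof -
  interpret G: pair_wf_digraph G by fact
  interpret H: pair_wf_digraph H by fact
  let ?h = "\<lparr>iso_verts = f, iso_arcs = map_prod f f, iso_head = snd, iso_tail = fst\<rparr>"
  have inj: "inj_on f (pverts G)" and im: "f ` pverts G = pverts H"
    using bij by (auto simp: bij_betw_def)
  have im_arcs: "map_prod f f ` parcs G = parcs H"
  proof (intro subset_antisym subsetI)
    fix e assume "e \<in> map_prod f f ` parcs G"
    then obtain u v where uv: "(u, v) \<in> parcs G" "e = (f u, f v)" by auto
    then show "e \<in> parcs H" using arcs[of u v] G.wellformed'[OF uv(1)] by simp
  next
    fix e assume e: "e \<in> parcs H"
    obtain x y where xy: "e = (x, y)" by (cases e)
    then have "x \<in> f ` pverts G" "y \<in> f ` pverts G"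
      using e H.wellformed'[of x y] im by simp_all
    then obtain u v where "u \<in> pverts G" "v \<in> pverts G" "x = f u" "y = f v" by auto
    then show "e \<in> map_prod f f ` parcs G"
      using arcs[of u v] e xy by (simp add: rev_image_eqI[of "(u, v)"])
  qed
  have "inj_on (map_prod f f) (pverts G \<times> pverts G)"
    using inj by (auto simp: inj_on_def)
  then have "inj_on (map_prod f f) (parcs G)"
    by (rule inj_on_subset) (auto dest: G.wellformed')
  then have "pre_digraph.digraph_isomorphism (with_proj G) ?h"
    using inj wfG by (simp add: pre_digraph.digraph_isomorphism_def wf_digraph_wp_iff)
  moreover have "with_proj H = app_iso ?h (with_proj G)"
    using im im_arcs by (simp add: app_iso_def with_proj_def)
  ultimately show ?thesis unfolding digraph_iso_def by blast
qed

lemma pair_isoE: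
  assumes "G \<simeq> H"
  obtains f where "bij_betw f (pverts G) (pverts H)"
    and "\<forall>u\<in>pverts G. \<forall>v\<in>pverts G. (u, v) \<in> parcs G \<longleftrightarrow> (f u, f v) \<in> parcs H"
proof -
  from assms obtain h
    where iso: "pre_digraph.digraph_isomorphism (with_proj G) h"
      and H: "with_proj H = app_iso h (with_proj G)"
    by (auto simp: digraph_iso_def)
  let ?f = "iso_verts h"
  have V: "pverts H = ?f ` pverts G" and A: "parcs H = iso_arcs h ` parcs G"
    and ht: "iso_head h = snd" "iso_tail h = fst"
    using H by (auto simp: with_proj_def app_iso_def)
  have wf: "pair_wf_digraph G" and inj: "inj_on ?f (pverts G)"
    and ends: "\<And>e. e \<in> parcs G \<Longrightarrow> iso_arcs h e = (?f (fst e), ?f (snd e))"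
    using iso ht by (auto simp: pre_digraph.digraph_isomorphism_def wf_digraph_wp_iff prod_eq_iff)
  interpret pair_wf_digraph G by (fact wf)
  show thesis
  proof (rule that)
    show "bij_betw ?f (pverts G) (pverts H)" using inj V by (auto simp: bij_betw_def)
  next
    show "\<forall>u\<in>pverts G. \<forall>v\<in>pverts G. (u, v) \<in> parcs G \<longleftrightarrow> (?f u, ?f v) \<in> parcs H"
    proof (intro ballI iffI)
      fix u v assume "(u, v) \<in> parcs G"
      then show "(?f u, ?f v) \<in> parcs H" using A ends by force
    next
      fix u v assume uv: "u \<in> pverts G" "v \<in> pverts G" and "(?f u, ?f v) \<in> parcs H"
      then obtain x y where xy: "(x, y) \<in> parcs G" and "?f x = ?f u" "?f y = ?f v"
        using A ends by force
      then show "(u, v) \<in> parcs G"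
        using inj uv wellformed'[OF xy] by (metis inj_onD)
    qed
  qed
qed

lemma pair_iso_card: "G \<simeq> H \<Longrightarrow> card (pverts G) = card (pverts H)"
  by (erule pair_isoE) (rule bij_betw_same_card)

section \<open>Disjoint unions\<close>

lemma pverts_disj_union [simp]:
  "pverts (disj_union G H) = Inl ` pverts G \<union> Inr ` pverts H"
  by (simp add: disj_union_def)

lemma parcs_disj_union [simp]:
  "(Inl u, Inl v) \<in> parcs (disj_union G H) \<longleftrightarrow> (u, v) \<in> parcs G"
  "(Inr x, Inr y) \<in> parcs (disj_union G H) \<longleftrightarrow> (x, y) \<in> parcs H"
  "(Inl u, Inr y) \<notin> parcs (disj_union G H)"
  "(Inr x, Inl v) \<notin> parcs (disj_union G H)"
  by (auto simp: disj_union_def)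

lemma pverts_disj_Union [simp]: "(i, u) \<in> pverts (disj_Union I G) \<longleftrightarrow> i \<in> I \<and> u \<in> pverts (G i)"
  by (simp add: disj_Union_def)

lemma parcs_disj_Union [simp]:
  "((i, u), (j, v)) \<in> parcs (disj_Union I G) \<longleftrightarrow> i \<in> I \<and> j = i \<and> (u, v) \<in> parcs (G i)"
  by (auto simp: disj_Union_def)

lemma pverts_copies [simp]:
  "(i, v) \<in> pverts (copies k G) \<longleftrightarrow> i \<in> {1..k} \<and> v \<in> pverts G"
  by (simp add: copies_def)

lemma parcs_copies [simp]:
  "((i, u), (j, v)) \<in> parcs (copies k G) \<longleftrightarrow> i \<in> {1..k} \<and> j = i \<and> (u, v) \<in> parcs G"
  by (simp add: copies_def)

lemma pair_wf_disj_union: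
  "pair_wf_digraph G \<Longrightarrow> pair_wf_digraph H \<Longrightarrow> pair_wf_digraph (disj_union G H)"
  by (auto simp: pair_wf_digraph_def disj_union_def)

lemma pair_wf_disj_Union:
  "(\<And>i. i \<in> I \<Longrightarrow> pair_wf_digraph (G i)) \<Longrightarrow> pair_wf_digraph (disj_Union I G)"
  by (fastforce simp: pair_wf_digraph_def disj_Union_def)

lemma pair_wf_copies: "pair_wf_digraph G \<Longrightarrow> pair_wf_digraph (copies k G)"
  by (simp add: copies_def pair_wf_disj_Union)

lemma pair_wf_path_graph: "pair_wf_digraph (path_graph r)"
  by (auto simp: pair_wf_digraph_def path_graph_def)

lemma pair_wf_cocktail_party: "pair_wf_digraph (cocktail_party n)"
  by (auto simp: pair_wf_digraph_def cocktail_party_def Let_def)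

lemmas pair_wf_intros =
  pair_wf_disj_union pair_wf_disj_Union pair_wf_copies pair_wf_path_graph pair_wf_cocktail_party

lemma card_disj_union:
  assumes "finite (pverts G)" "finite (pverts H)"
  shows "card (pverts (disj_union G H)) = card (pverts G) + card (pverts H)"
  unfolding pverts_disj_union using assms
  by (subst card_Un_disjoint) (auto simp: card_image)

lemma card_disj_Union:
  assumes "finite I" "\<And>i. i \<in> I \<Longrightarrow> finite (pverts (G i))"
  shows "finite (pverts (disj_Union I G))"
    and "card (pverts (disj_Union I G)) = (\<Sum>i\<in>I. card (pverts (G i)))"
  using assms by (auto simp: disj_Union_def)

lemma card_copies:
  assumes "finite (pverts G)"
  shows "finite (pverts (copies k G))" "card (pverts (copies k G)) = k * card (pverts G)"
  using assms by (simp_all add: copies_def card_disj_Union)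

lemma card_path_graph: "finite (pverts (path_graph r))" "card (pverts (path_graph r)) = r"
  by (simp_all add: path_graph_def)

lemma path_graph_2: "path_graph 2 = \<lparr>pverts = {1, 2}, parcs = {(1, 2), (2, 1)}\<rparr>"
proof -
  have I: "{1..2} = {1, 2::nat}"
    by (rule set_eqI, unfold atLeastAtMost_iff insert_iff empty_iff) arith
  show ?thesis unfolding path_graph_def I by auto
qed

lemma path_graph_4: "path_graph 4 = \<lparr>pverts = {1, 2, 3, 4},
    parcs = {(1, 2), (2, 1), (2, 3), (3, 2), (3, 4), (4, 3)}\<rparr>"
proof -
  have I: "{1..4} = {1, 2, 3, 4::nat}"
    by (rule set_eqI, unfold atLeastAtMost_iff insert_iff empty_iff) arith
  show ?thesis unfolding path_graph_def I by auto
qed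

lemma pverts_cocktail_party: "pverts (cocktail_party n) = Inl ` {1..n} \<union> Inr ` {1..n}"
  by (simp add: cocktail_party_def Let_def)

text \<open>
  The map \<open>case_sum Inr Inl\<close> exchanges \<open>u\<^sub>i\<close> and \<open>v\<^sub>i\<close>. This description of the arcs by an
  involution is the one that can be matched with the partner map of a graph.
\<close>

lemma parcs_cocktail_party:
  "(x, y) \<in> parcs (cocktail_party n) \<longleftrightarrow>
    x \<in> pverts (cocktail_party n) \<and> y \<in> pverts (cocktail_party n)
    \<and> x \<noteq> y \<and> y \<noteq> case_sum Inr Inl x"
  by (cases x; cases y) (auto simp: cocktail_party_def Let_def)

lemma card_cocktail_party:
  "finite (pverts (cocktail_party n))" "card (pverts (cocktail_party n)) = 2 * n"
proof -
  have "card (Inl ` {1..n} \<union> Inr ` {1..n} :: (nat + nat) set) = n + n"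
    by (subst card_Un_disjoint) (auto simp: card_image)
  then show "finite (pverts (cocktail_party n))" "card (pverts (cocktail_party n)) = 2 * n"
    by (simp_all add: cocktail_party_def Let_def)
qed

abbreviation P4_CP_union :: "nat \<Rightarrow> nat set \<Rightarrow> (nat \<Rightarrow> nat)
    \<Rightarrow> (nat \<times> nat + nat \<times> nat \<times> (nat + nat)) pair_pre_digraph" where
  "P4_CP_union p N q \<equiv> disj_union (copies p (path_graph 4))
     (disj_Union N (\<lambda>n. copies (q n) (cocktail_party n)))"

lemma pair_wf_P4_CP_union: "pair_wf_digraph (P4_CP_union p N q)"
  by (intro pair_wf_intros)

lemma card_P4_CP_union:
  assumes "finite N"
  shows "card (pverts (P4_CP_union p N q)) = 2 * (2 * p + (\<Sum>n\<in>N. q n * n))"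
  using assms
  by (simp add: card_disj_union card_disj_Union card_copies card_path_graph card_cocktail_party
      sum_distrib_left algebra_simps del: pverts_disj_union)

lemma disj_union_cong:
  assumes "G \<simeq> G'" "H \<simeq> H'"
    and wf: "pair_wf_digraph G" "pair_wf_digraph G'" "pair_wf_digraph H" "pair_wf_digraph H'"
  shows "disj_union G H \<simeq> disj_union G' H'"
proof -
  from assms(1) obtain f where f: "bij_betw f (pverts G) (pverts G')"
    "\<forall>u\<in>pverts G. \<forall>v\<in>pverts G. (u, v) \<in> parcs G \<longleftrightarrow> (f u, f v) \<in> parcs G'"
    by (rule pair_isoE)
  from assms(2) obtain g where g: "bij_betw g (pverts H) (pverts H')"
    "\<forall>u\<in>pverts H. \<forall>v\<in>pverts H. (u, v) \<in> parcs H \<longleftrightarrow> (g u, g v) \<in> parcs H'"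
    by (rule pair_isoE)
  show ?thesis
  proof (rule pair_isoI[where f = "map_sum f g"])
    show "bij_betw (map_sum f g) (pverts (disj_union G H)) (pverts (disj_union G' H'))"
      using f(1) g(1) by (simp add: bij_betw_def inj_on_def image_Un image_image ball_Un)
        (metis image_image)
  next
    fix u v assume "u \<in> pverts (disj_union G H)" "v \<in> pverts (disj_union G H)"
    then show "(u, v) \<in> parcs (disj_union G H) \<longleftrightarrow>
        (map_sum f g u, map_sum f g v) \<in> parcs (disj_union G' H')"
      using f(2) g(2) by (cases u; cases v) auto
  qed (simp_all add: wf pair_wf_disj_union)
qed

text \<open>
  Components are both split off from a graph and attached to a disjoint union by this criterion:
  two graphs make up a third if they embed into it with complementary images and without arcs
  between the images.
\<close>

lemma disj_union_isoI:
  assumes wf: "pair_wf_digraph K" "pair_wf_digraph H" "pair_wf_digraph L"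
    and inj: "inj_on f (pverts K)" "inj_on g (pverts H)" "f ` pverts K \<inter> g ` pverts H = {}"
    and V: "pverts L = f ` pverts K \<union> g ` pverts H"
    and K: "\<And>u v. u \<in> pverts K \<Longrightarrow> v \<in> pverts K \<Longrightarrow> (f u, f v) \<in> parcs L \<longleftrightarrow> (u, v) \<in> parcs K"
    and H: "\<And>x y. x \<in> pverts H \<Longrightarrow> y \<in> pverts H \<Longrightarrow> (g x, g y) \<in> parcs L \<longleftrightarrow> (x, y) \<in> parcs H"
    and cross: "\<And>u x. u \<in> pverts K \<Longrightarrow> x \<in> pverts H \<Longrightarrow>
      (f u, g x) \<notin> parcs L \<and> (g x, f u) \<notin> parcs L"
  shows "disj_union K H \<simeq> L"
proof (rule pair_isoI[where f = "case_sum f g"])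
  have "inj_on (case_sum f g) (pverts (disj_union K H))"
  proof (rule inj_onI)
    fix u v assume u: "u \<in> pverts (disj_union K H)" and v: "v \<in> pverts (disj_union K H)"
      and eq: "case_sum f g u = case_sum f g v"
    show "u = v"
    proof (cases u; cases v)
      fix a b assume "u = Inl a" "v = Inl b"
      with u v eq show ?thesis using inj_onD[OF inj(1), of a b] by auto
    next
      fix a b assume "u = Inr a" "v = Inr b"
      with u v eq show ?thesis using inj_onD[OF inj(2), of a b] by auto
    next
      fix a b assume "u = Inl a" "v = Inr b"
      with u v eq show ?thesis using inj(3) unfolding disjoint_iff by (simp add: image_iff) metis
    next
      fix a b assume "u = Inr a" "v = Inl b"
      with u v eq show ?thesis using inj(3) unfolding disjoint_iff by (simp add: image_iff) metis
    qed
  qed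
  moreover have "case_sum f g ` pverts (disj_union K H) = pverts L"
    by (simp add: V image_Un image_image)
  ultimately show "bij_betw (case_sum f g) (pverts (disj_union K H)) (pverts L)"
    by (simp add: bij_betw_def)
next
  fix u v assume "u \<in> pverts (disj_union K H)" "v \<in> pverts (disj_union K H)"
  then show "(u, v) \<in> parcs (disj_union K H) \<longleftrightarrow> (case_sum f g u, case_sum f g v) \<in> parcs L"
    by (cases u; cases v) (force simp: K H cross)+
qed (simp_all add: wf pair_wf_disj_union)

text \<open>
  The existing copies carry the tags \<open>1\<close> to \<open>p\<close>, so \<open>Suc p\<close> is free for the new one.
\<close>

lemma add_P4: "disj_union (path_graph 4) (P4_CP_union p N q) \<simeq> P4_CP_union (Suc p) N q"
proof (rule disj_union_isoI[where f = "\<lambda>v. Inl (Suc p, v)" and g = id])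
  show "pverts (P4_CP_union (Suc p) N q)
      = (\<lambda>v. Inl (Suc p, v)) ` pverts (path_graph 4) \<union> id ` pverts (P4_CP_union p N q)"
  proof (rule set_eqI)
    fix z
    show "z \<in> pverts (P4_CP_union (Suc p) N q) \<longleftrightarrow>
        z \<in> (\<lambda>v. Inl (Suc p, v)) ` pverts (path_graph 4) \<union> id ` pverts (P4_CP_union p N q)"
      by (cases z) (auto simp: image_iff le_Suc_eq)
  qed
next
  fix x y assume "x \<in> pverts (P4_CP_union p N q)" "y \<in> pverts (P4_CP_union p N q)"
  then show "(id x, id y) \<in> parcs (P4_CP_union (Suc p) N q) \<longleftrightarrow> (x, y) \<in> parcs (P4_CP_union p N q)"
    by (cases x; cases y) auto
next
  fix u x assume "x \<in> pverts (P4_CP_union p N q)"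
  then show "(Inl (Suc p, u), id x) \<notin> parcs (P4_CP_union (Suc p) N q) \<and>
      (id x, Inl (Suc p, u)) \<notin> parcs (P4_CP_union (Suc p) N q)"
    by (cases x) auto
qed (auto simp: inj_on_def intro: pair_wf_P4_CP_union pair_wf_path_graph)

lemma add_CP:
  assumes m: "m \<in> N"
  shows "disj_union (cocktail_party m) (P4_CP_union p N q)
    \<simeq> P4_CP_union p N (q(m := Suc (q m)))"
proof (rule disj_union_isoI[where f = "\<lambda>v. Inr (m, Suc (q m), v)" and g = id])
  show "pverts (P4_CP_union p N (q(m := Suc (q m))))
      = (\<lambda>v. Inr (m, Suc (q m), v)) ` pverts (cocktail_party m) \<union> id ` pverts (P4_CP_union p N q)"
  proof (rule set_eqI)
    fix z
    show "z \<in> pverts (P4_CP_union p N (q(m := Suc (q m)))) \<longleftrightarrow>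
        z \<in> (\<lambda>v. Inr (m, Suc (q m), v)) ` pverts (cocktail_party m) \<union> id ` pverts (P4_CP_union p N q)"
      using m by (cases z) (auto simp: image_iff le_Suc_eq split: if_splits)
  qed
next
  fix x y assume "x \<in> pverts (P4_CP_union p N q)" "y \<in> pverts (P4_CP_union p N q)"
  then show "(id x, id y) \<in> parcs (P4_CP_union p N (q(m := Suc (q m)))) \<longleftrightarrow>
      (x, y) \<in> parcs (P4_CP_union p N q)"
    by (cases x; cases y) auto
next
  fix u x assume "x \<in> pverts (P4_CP_union p N q)"
  then show "(Inr (m, Suc (q m), u), id x) \<notin> parcs (P4_CP_union p N (q(m := Suc (q m)))) \<and>
      (id x, Inr (m, Suc (q m), u)) \<notin> parcs (P4_CP_union p N (q(m := Suc (q m))))"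
    by (cases x) auto
qed (use m in \<open>auto simp: inj_on_def intro: pair_wf_P4_CP_union pair_wf_cocktail_party\<close>)

section \<open>The 2-distance graph\<close>

lemma pverts_T2 [simp]: "pverts (T2 X) = pverts X"
  by (simp add: T2_def)

lemma pair_wf_T2: "pair_wf_digraph (T2 X)"
  by (auto simp: pair_wf_digraph_def T2_def)

text \<open>
  A distance of \<open>2\<close> is a local condition: it forbids walks of length \<open>0\<close> and \<open>1\<close> and provides
  one of length \<open>2\<close>. All later arguments use this form and no walks.
\<close>

lemma parcs_T2:
  assumes "pair_wf_digraph X"
  shows "(u, v) \<in> parcs (T2 X) \<longleftrightarrow>
    u \<noteq> v \<and> (u, v) \<notin> parcs X \<and> (\<exists>w. (u, w) \<in> parcs X \<and> (w, v) \<in> parcs X)"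
    (is "_ \<longleftrightarrow> ?R")
proof -
  interpret pair_wf_digraph X by fact
  have gd: "gdist X u v = (INF p\<in>{p. awalk u p v}. ereal (real (length p)))"
    by (simp add: gdist_def \<mu>_def awalk_cost_def sum_list_triv)
  show ?thesis
  proof
    assume uv: "(u, v) \<in> parcs (T2 X)"
    then have dist: "gdist X u v = 2" and V: "u \<in> pverts X" "v \<in> pverts X"
      by (auto simp: T2_def)
    have lower: "2 \<le> length p" if "awalk u p v" for p
    proof -
      have "gdist X u v \<le> ereal (real (length p))"
        unfolding gd using that by (intro INF_lower) simp
      then have "ereal 2 \<le> ereal (real (length p))" unfolding dist by simp
      then show ?thesis by simp
    qed
    \<comment> \<open>The bound \<open>3\<close> lets the infimum provide an actual walk, whose length is then exactly \<open>2\<close>.\<close>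
    have "(INF p\<in>{p. awalk u p v}. ereal (real (length p))) < ereal 3"
      using dist unfolding gd by simp
    then obtain p where p: "awalk u p v" "length p < 3"
      unfolding INF_less_iff by auto
    with lower[of p] have "length p = 2" by simp
    then obtain e e' where "p = [e, e']" by (auto simp: length_Suc_conv numeral_2_eq_2)
    with p have "(u, snd e) \<in> parcs X" "(snd e, v) \<in> parcs X"
      by (cases e; cases e'; auto simp: awalk_def)+
    moreover have "u \<noteq> v" using lower[of "[]"] V by (auto simp: awalk_def)
    moreover have "(u, v) \<notin> parcs X" using lower[of "[(u, v)]"] V by (auto simp: awalk_def)
    ultimately show ?R by blast
  next
    assume R: ?R
    then obtain w where w: "(u, w) \<in> parcs X" "(w, v) \<in> parcs X" by blast
    then have V: "u \<in> pverts X" "v \<in> pverts X" using wellformed' by auto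
    have "gdist X u v \<le> ereal (real (length [(u, w), (w, v)]))"
      unfolding gd using w V by (intro INF_lower) (simp add: awalk_def)
    moreover have "2 \<le> length p" if "awalk u p v" for p
    proof (rule ccontr)
      assume "\<not> 2 \<le> length p"
      then consider "p = []" | e where "p = [e]" by (cases p; cases "tl p") auto
      then show False using that R by cases (auto simp: awalk_def)
    qed
    then have "ereal 2 \<le> gdist X u v"
      unfolding gd by (intro INF_greatest) auto
    ultimately have "gdist X u v = 2" by (simp add: antisym)
    then show "(u, v) \<in> parcs (T2 X)" using V by (simp add: T2_def)
  qed
qed

lemma T2_cong:
  assumes wf: "pair_wf_digraph X" "pair_wf_digraph Y" and "X \<simeq> Y"
  shows "T2 X \<simeq> T2 Y"
proof -
  interpret X: pair_wf_digraph X by fact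
  interpret Y: pair_wf_digraph Y by fact
  from \<open>X \<simeq> Y\<close> obtain f where bij: "bij_betw f (pverts X) (pverts Y)"
    and arcs: "\<forall>u\<in>pverts X. \<forall>v\<in>pverts X. (u, v) \<in> parcs X \<longleftrightarrow> (f u, f v) \<in> parcs Y"
    by (rule pair_isoE)
  show ?thesis
  proof (rule pair_isoI[where f = f])
    fix u v assume "u \<in> pverts (T2 X)" "v \<in> pverts (T2 X)"
    then have uv: "u \<in> pverts X" "v \<in> pverts X" by auto
    have "f u = f v \<longleftrightarrow> u = v" using bij uv by (auto simp: bij_betw_def inj_on_def)
    moreover have "(\<exists>w. (u, w) \<in> parcs X \<and> (w, v) \<in> parcs X) \<longleftrightarrow>
      (\<exists>w. (f u, w) \<in> parcs Y \<and> (w, f v) \<in> parcs Y)"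
    proof
      assume "\<exists>w. (u, w) \<in> parcs X \<and> (w, v) \<in> parcs X"
      then show "\<exists>w. (f u, w) \<in> parcs Y \<and> (w, f v) \<in> parcs Y"
        using arcs uv X.wellformed' by blast
    next
      assume "\<exists>w. (f u, w) \<in> parcs Y \<and> (w, f v) \<in> parcs Y"
      then obtain w where w: "(f u, w) \<in> parcs Y" "(w, f v) \<in> parcs Y" by blast
      then have "w \<in> f ` pverts X" using Y.wellformed' bij by (auto simp: bij_betw_def)
      then show "\<exists>w. (u, w) \<in> parcs X \<and> (w, v) \<in> parcs X" using w arcs uv by auto
    qed
    ultimately show "(u, v) \<in> parcs (T2 X) \<longleftrightarrow> (f u, f v) \<in> parcs (T2 Y)"
      using arcs uv by (simp add: parcs_T2 wf)
  qed (use bij pair_wf_T2 in auto)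
qed

lemma pair_pre_digraph_eqI:
  fixes G H :: "'a pair_pre_digraph"
  assumes "pverts G = pverts H" "\<And>u v. (u, v) \<in> parcs G \<longleftrightarrow> (u, v) \<in> parcs H"
  shows "G = H"
  using assms by (intro pair_pre_digraph.equality) auto

text \<open>
  The middle vertex of a walk of length \<open>2\<close> lies in the same part as both ends, so new pairs at
  distance \<open>2\<close> cannot arise between the parts.
\<close>

lemma T2_disj_union:
  assumes "pair_wf_digraph G" "pair_wf_digraph H"
  shows "T2 (disj_union G H) = disj_union (T2 G) (T2 H)"
proof (rule pair_pre_digraph_eqI)
  fix u v
  show "(u, v) \<in> parcs (T2 (disj_union G H)) \<longleftrightarrow> (u, v) \<in> parcs (disj_union (T2 G) (T2 H))"
    using assms by (cases u; cases v) (auto simp: parcs_T2 pair_wf_disj_union split_sum_ex)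
qed simp

lemma T2_disj_Union:
  assumes "\<And>i. i \<in> I \<Longrightarrow> pair_wf_digraph (G i)"
  shows "T2 (disj_Union I G) = disj_Union I (\<lambda>i. T2 (G i))"
proof (rule pair_pre_digraph_eqI)
  fix u v
  show "(u, v) \<in> parcs (T2 (disj_Union I G)) \<longleftrightarrow> (u, v) \<in> parcs (disj_Union I (\<lambda>i. T2 (G i)))"
    using assms by (cases u; cases v) (auto simp: parcs_T2 pair_wf_disj_Union)
qed (simp add: disj_Union_def)

section \<open>Perfect matchings\<close>

text \<open>
  For symmetric arcs without loops this says that the edges form a perfect matching.
\<close>

definition one_regular :: "'a pair_pre_digraph \<Rightarrow> bool" where
  "one_regular G \<longleftrightarrow> (\<forall>v\<in>pverts G. \<exists>!w. (v, w) \<in> parcs G)"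

lemma one_regular_iso:
  assumes wf: "pair_wf_digraph G" "pair_wf_digraph H" and iso: "G \<simeq> H" and H: "one_regular H"
  shows "one_regular G"
  unfolding one_regular_def
proof
  interpret G: pair_wf_digraph G by fact
  interpret H: pair_wf_digraph H by fact
  from iso obtain f where bij: "bij_betw f (pverts G) (pverts H)"
    and arcs: "\<forall>u\<in>pverts G. \<forall>v\<in>pverts G. (u, v) \<in> parcs G \<longleftrightarrow> (f u, f v) \<in> parcs H"
    by (rule pair_isoE)
  fix v assume v: "v \<in> pverts G"
  then have "f v \<in> pverts H" using bij by (auto simp: bij_betw_def)
  then obtain y where y: "(f v, y) \<in> parcs H" "\<And>z. (f v, z) \<in> parcs H \<Longrightarrow> z = y"
    using H unfolding one_regular_def by blast
  have "y \<in> f ` pverts G" using H.wellformed'(2)[OF y(1)] bij by (simp add: bij_betw_def)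
  then obtain w where w: "w \<in> pverts G" "y = f w" by blast
  show "\<exists>!w. (v, w) \<in> parcs G"
  proof (rule ex1I[of _ w])
    show "(v, w) \<in> parcs G" using arcs v w y(1) by simp
    fix z assume z: "(v, z) \<in> parcs G"
    then have zG: "z \<in> pverts G" by (rule G.wellformed')
    then have "(f v, f z) \<in> parcs H" using arcs v z by simp
    then have "f z = f w" using y(2)[of "f z"] w by simp
    then show "z = w" using bij w zG inj_onD[of f "pverts G" z w] by (simp add: bij_betw_def)
  qed
qed

lemma ex1_inj_image: "inj h \<Longrightarrow> (\<exists>!w. \<exists>v. w = h v \<and> P v) \<longleftrightarrow> (\<exists>!v. P v)"
  unfolding inj_def by metis

lemma one_regular_disj_union:
  "one_regular (disj_union G H) \<longleftrightarrow> one_regular G \<and> one_regular H"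
proof -
  have "(Inl u, w) \<in> parcs (disj_union G H) \<longleftrightarrow> (\<exists>v. w = Inl v \<and> (u, v) \<in> parcs G)" for u w
    by (cases w) simp_all
  moreover have "(Inr x, w) \<in> parcs (disj_union G H) \<longleftrightarrow> (\<exists>y. w = Inr y \<and> (x, y) \<in> parcs H)" for x w
    by (cases w) simp_all
  ultimately show ?thesis
    unfolding one_regular_def pverts_disj_union ball_Un ball_simps by (simp add: ex1_inj_image)
qed

lemma one_regular_disj_Union:
  assumes "\<And>i. i \<in> I \<Longrightarrow> one_regular (G i)"
  shows "one_regular (disj_Union I G)"
  unfolding one_regular_def
proof
  fix x assume x: "x \<in> pverts (disj_Union I G)"
  obtain i u where iu: "x = (i, u)" by (cases x)
  with x have "i \<in> I" "u \<in> pverts (G i)" by auto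
  then have "(x, y) \<in> parcs (disj_Union I G) \<longleftrightarrow> (\<exists>w. y = Pair i w \<and> (u, w) \<in> parcs (G i))" for y
    unfolding iu by (cases y) simp
  moreover have "\<exists>!w. (u, w) \<in> parcs (G i)"
    using assms \<open>i \<in> I\<close> \<open>u \<in> pverts (G i)\<close> by (simp add: one_regular_def)
  ultimately show "\<exists>!y. (x, y) \<in> parcs (disj_Union I G)"
    by (simp add: ex1_inj_image inj_def)
qed

lemma one_regular_P2: "one_regular (path_graph 2)"
  by (simp add: one_regular_def path_graph_2)

text \<open>
  On the path \<open>1 - 2 - 3 - 4\<close> the pairs at distance \<open>2\<close> are \<open>1, 3\<close> and \<open>2, 4\<close>.
\<close>

lemma one_regular_T2_P4: "one_regular (T2 (path_graph 4))"
proof -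
  have V: "pverts (path_graph 4) = {1, 2, 3, 4}"
    and A: "parcs (path_graph 4) = {(1, 2), (2, 1), (2, 3), (3, 2), (3, 4), (4, 3)}"
    by (simp_all add: path_graph_4)
  have two: "(\<exists>w. (u, w) \<in> parcs (path_graph 4) \<and> (w, v) \<in> parcs (path_graph 4)) \<longleftrightarrow>
      (u, v) \<in> {(1, 1), (1, 3), (2, 2), (2, 4), (3, 1), (3, 3), (4, 2), (4, 4)}"
    if "u \<in> {1, 2, 3, 4}" for u v
    using that unfolding A insert_iff empty_iff
    by (elim disjE) (simp add: conj_disj_distribR ex_disj_distrib; blast?)+
  have T: "(u, v) \<in> parcs (T2 (path_graph 4)) \<longleftrightarrow> (u, v) \<in> {(1, 3), (3, 1), (2, 4), (4, 2)}"
    if "u \<in> {1, 2, 3, 4}" for u v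
    using that unfolding parcs_T2[OF pair_wf_path_graph] two[OF that] A insert_iff empty_iff
    by (elim disjE) (simp; presburger)+
  show ?thesis unfolding one_regular_def pverts_T2 V using T by simp
qed

lemma one_regular_T2_CP:
  assumes "n \<ge> 2"
  shows "one_regular (T2 (cocktail_party n))"
proof -
  note V = pverts_cocktail_party and A = parcs_cocktail_party
  have T: "(x, y) \<in> parcs (T2 (cocktail_party n)) \<longleftrightarrow> y = case_sum Inr Inl x"
    if x: "x \<in> pverts (cocktail_party n)" for x y
  proof
    assume "(x, y) \<in> parcs (T2 (cocktail_party n))"
    then show "y = case_sum Inr Inl x"
      unfolding parcs_T2[OF pair_wf_cocktail_party] A by auto
  next
    assume y: "y = case_sum Inr Inl x"
    define i where "i = case_sum id id x"
    \<comment> \<open>Any vertex of a second pair is a common neighbour of \<open>x\<close> and its mate; for this the graph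
      must have two pairs.\<close>
    define j where "j = (if i = 1 then 2 else 1 :: nat)"
    have j: "j \<in> {1..n}" "j \<noteq> i" using assms by (auto simp: j_def)
    have x_cases: "x = Inl i \<or> x = Inr i" by (cases x) (auto simp: i_def)
    have i: "i \<in> {1..n}" using x by (auto simp: i_def V)
    have "(x, Inl j) \<in> parcs (cocktail_party n)" "(Inl j, y) \<in> parcs (cocktail_party n)"
      "x \<noteq> y" "(x, y) \<notin> parcs (cocktail_party n)"
      using x_cases i j y by (auto simp: A V)
    then show "(x, y) \<in> parcs (T2 (cocktail_party n))"
      unfolding parcs_T2[OF pair_wf_cocktail_party] by blast
  qed
  show ?thesis unfolding one_regular_def using T by auto
qed

lemma one_regular_T2_P4_CP_union:
  assumes "\<forall>n\<in>N. n \<ge> 2"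
  shows "one_regular (T2 (P4_CP_union p N q))"
  using assms
  by (simp add: copies_def T2_disj_union T2_disj_Union pair_wf_intros one_regular_disj_union
      one_regular_disj_Union one_regular_T2_P4 one_regular_T2_CP)

text \<open>
  Both a perfect matching and a cocktail party graph consist of a vertex set and an involution
  without fixed points. Numbering its orbits, and ordering the two points of each, makes it the
  exchange of \<open>Inl i\<close> and \<open>Inr i\<close>.
\<close>

lemma involution_enumeration:
  assumes "finite C" and "\<forall>x\<in>C. s x \<in> C \<and> s (s x) = x \<and> s x \<noteq> x"
  shows "\<exists>n (g :: 'a \<Rightarrow> nat + nat). bij_betw g C (Inl ` {1..n} \<union> Inr ` {1..n})
    \<and> (\<forall>x\<in>C. g (s x) = case_sum Inr Inl (g x))"
  using assms
proof (induction C rule: finite_psubset_induct)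
  case (psubset C)
  show ?case
  proof (cases "C = {}")
    case True
    then show ?thesis by (intro exI[of _ 0] exI[of _ "\<lambda>_. Inl 0"]) (simp add: bij_betw_def)
  next
    case False
    then obtain x where x: "x \<in> C" by blast
    let ?C = "C - {x, s x}"
    have "?C \<subset> C" using x by blast
    moreover have "\<forall>y\<in>?C. s y \<in> ?C \<and> s (s y) = y \<and> s y \<noteq> y"
      using psubset.prems x by (metis Diff_iff empty_iff insert_iff)
    ultimately obtain n and g :: "'a \<Rightarrow> nat + nat"
      where g: "bij_betw g ?C (Inl ` {1..n} \<union> Inr ` {1..n})"
        and gs: "\<forall>y\<in>?C. g (s y) = case_sum Inr Inl (g y)"
      using psubset.IH[of ?C] by blast
    let ?g = "g(x := Inl (Suc n), s x := Inr (Suc n))"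
    have sx: "s x \<noteq> x" "s x \<in> C" "s (s x) = x" using psubset.prems x by auto
    have "bij_betw ?g ?C (Inl ` {1..n} \<union> Inr ` {1..n})"
      using g by (subst bij_betw_cong[where g = g]) auto
    moreover have "bij_betw ?g {x, s x} {Inl (Suc n), Inr (Suc n)}"
      using sx by (auto simp: bij_betw_def)
    ultimately have "bij_betw ?g (?C \<union> {x, s x})
        ((Inl ` {1..n} \<union> Inr ` {1..n}) \<union> {Inl (Suc n), Inr (Suc n)})"
      by (rule bij_betw_combine) auto
    moreover have "?C \<union> {x, s x} = C" using x sx by blast
    moreover have "(Inl ` {1..n} \<union> Inr ` {1..n}) \<union> {Inl (Suc n), Inr (Suc n)}
        = Inl ` {1..Suc n} \<union> Inr ` {1..Suc n}"
      by (auto simp: atLeastAtMostSuc_conv)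
    ultimately have "bij_betw ?g C (Inl ` {1..Suc n} \<union> Inr ` {1..Suc n})" by simp
    moreover have "?g (s y) = case_sum Inr Inl (?g y)" if y: "y \<in> C" for y
    proof -
      consider "y = x" | "y = s x" | "y \<in> ?C" using y by blast
      then show ?thesis
      proof cases
        case 3
        then have "s y \<noteq> x" "s y \<noteq> s x" using psubset.prems y x by (metis DiffE insertCI)+
        then show ?thesis using 3 gs by simp
      qed (use sx in auto)
    qed
    ultimately show ?thesis by blast
  qed
qed

lemma one_regular_partner:
  assumes "one_regular G"
  obtains s where "\<forall>v\<in>pverts G. \<forall>w. (v, w) \<in> parcs G \<longleftrightarrow> w = s v"
proof
  show "\<forall>v\<in>pverts G. \<forall>w. (v, w) \<in> parcs G \<longleftrightarrow> w = (THE w. (v, w) \<in> parcs G)"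
  proof (intro ballI allI)
    fix v w assume "v \<in> pverts G"
    with assms have ex: "\<exists>!w. (v, w) \<in> parcs G" by (simp add: one_regular_def)
    then have "(v, THE w. (v, w) \<in> parcs G) \<in> parcs G" by (rule theI')
    with ex show "(v, w) \<in> parcs G \<longleftrightarrow> w = (THE w. (v, w) \<in> parcs G)" by blast
  qed
qed

text \<open>
  The two ends of the \<open>i\<close>-th edge become the vertices \<open>1\<close> and \<open>2\<close> of the \<open>i\<close>-th copy of the
  path of order \<open>2\<close>.
\<close>

lemma one_regular_iso_kP2:
  assumes wf: "pair_wf_digraph G" and fin: "finite (pverts G)" and reg: "one_regular G"
    and sym: "\<And>u v. (u, v) \<in> parcs G \<Longrightarrow> (v, u) \<in> parcs G \<and> u \<noteq> v"
    and card: "card (pverts G) = 2 * k"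
  shows "G \<simeq> copies k (path_graph 2)"
proof -
  interpret pair_wf_digraph G by fact
  from reg obtain s where "\<forall>v\<in>pverts G. \<forall>w. (v, w) \<in> parcs G \<longleftrightarrow> w = s v"
    by (rule one_regular_partner)
  then have s: "(v, w) \<in> parcs G \<longleftrightarrow> w = s v" if "v \<in> pverts G" for v w
    using that by blast
  have "s x \<in> pverts G \<and> s (s x) = x \<and> s x \<noteq> x" if x: "x \<in> pverts G" for x
  proof -
    have xs: "(x, s x) \<in> parcs G" using s[OF x] by simp
    then have sx: "s x \<in> pverts G" by (rule wellformed'(2))
    have "(s x, x) \<in> parcs G" "x \<noteq> s x" using sym[OF xs] by blast+
    then show ?thesis using s[OF sx, of x] sx by metis
  qed
  then have "\<forall>x\<in>pverts G. s x \<in> pverts G \<and> s (s x) = x \<and> s x \<noteq> x" by blast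
  from involution_enumeration[OF fin this]
  obtain n and g :: "'a \<Rightarrow> nat + nat" where g: "bij_betw g (pverts G) (Inl ` {1..n} \<union> Inr ` {1..n})"
    and gs: "\<forall>x\<in>pverts G. g (s x) = case_sum Inr Inl (g x)"
    by blast
  have "2 * k = 2 * n"
    using bij_betw_same_card[OF g] card card_cocktail_party(2)[of n]
    by (simp add: pverts_cocktail_party)
  then have n: "n = k" by simp
  let ?h = "case_sum (\<lambda>i. (i, 1)) (\<lambda>i. (i, 2)) :: nat + nat \<Rightarrow> nat \<times> nat"
  have h: "bij_betw ?h (Inl ` {1..k} \<union> Inr ` {1..k}) (pverts (copies k (path_graph 2)))"
  proof -
    have "inj_on ?h (Inl ` {1..k} \<union> Inr ` {1..k})"
      by (auto simp: inj_on_def)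
    moreover have "?h ` (Inl ` {1..k} \<union> Inr ` {1..k}) = pverts (copies k (path_graph 2))"
      unfolding copies_def disj_Union_def path_graph_2 image_Un image_image by auto
    ultimately show ?thesis by (rule bij_betw_imageI)
  qed
  show ?thesis
  proof (rule pair_isoI[where f = "?h \<circ> g"])
    show "bij_betw (?h \<circ> g) (pverts G) (pverts (copies k (path_graph 2)))"
      by (rule bij_betw_trans[OF g[unfolded n] h])
  next
    fix u v assume u: "u \<in> pverts G" and v: "v \<in> pverts G"
    have g_in: "g x \<in> Inl ` {1..k} \<union> Inr ` {1..k}" if "x \<in> pverts G" for x
      using bij_betwE[OF g] that n by blast
    have "s u \<in> pverts G" using s[OF u] wellformed' by blast
    then have "g v = g (s u) \<longleftrightarrow> v = s u"
      using v bij_betw_imp_inj_on[OF g] by (simp add: inj_on_eq_iff)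
    then have "(u, v) \<in> parcs G \<longleftrightarrow> g v = g (s u)"
      using s[OF u] by simp
    also have "\<dots> \<longleftrightarrow> g v = case_sum Inr Inl (g u)" using gs u by simp
    also have "\<dots> \<longleftrightarrow> ((?h \<circ> g) u, (?h \<circ> g) v) \<in> parcs (copies k (path_graph 2))"
      using g_in[OF u] g_in[OF v] by (cases "g u"; cases "g v") (auto simp: path_graph_2)
    finally show "(u, v) \<in> parcs G \<longleftrightarrow>
      ((?h \<circ> g) u, (?h \<circ> g) v) \<in> parcs (copies k (path_graph 2))" .
  qed (simp_all add: wf pair_wf_copies pair_wf_path_graph)
qed

section \<open>Components of a graph whose 2-distance graph is a perfect matching\<close>

definition induced :: "'a pair_pre_digraph \<Rightarrow> 'a set \<Rightarrow> 'a pair_pre_digraph" where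
  "induced X S = \<lparr>pverts = pverts X \<inter> S, parcs = parcs X \<inter> S \<times> S\<rparr>"

lemma pverts_induced [simp]: "pverts (induced X S) = pverts X \<inter> S"
  and parcs_induced [simp]: "(u, v) \<in> parcs (induced X S) \<longleftrightarrow> (u, v) \<in> parcs X \<and> u \<in> S \<and> v \<in> S"
  by (auto simp: induced_def)

lemma pair_graph_induced:
  assumes "pair_graph X"
  shows "pair_graph (induced X S)"
proof -
  interpret pair_graph X by fact
  show ?thesis
  proof unfold_locales
    show "symmetric (with_proj (induced X S))"
      by (auto simp: symmetric_def induced_def intro!: symI arcs_symmetric)
  qed (auto simp: induced_def pair_finite_verts pair_finite_arcs no_loops' dest: wellformed')
qed

lemma pair_graph_imp_wf: "pair_graph X \<Longrightarrow> pair_wf_digraph X"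
  by (simp add: pair_graph_def pair_digraph_def pair_fin_digraph_def)

lemma iso_disj_union_induced:
  assumes X: "pair_graph X" and closed: "\<And>u v. (u, v) \<in> parcs X \<Longrightarrow> u \<in> C \<longleftrightarrow> v \<in> C"
  shows "X \<simeq> disj_union (induced X C) (induced X (- C))"
proof -
  have wf: "pair_wf_digraph (induced X S)" for S
    using pair_graph_induced[OF X] by (rule pair_graph_imp_wf)
  have wfX: "pair_wf_digraph X"
    using X by (rule pair_graph_imp_wf)
  have "disj_union (induced X C) (induced X (- C)) \<simeq> X"
    by (rule disj_union_isoI[where f = id and g = id]) (use wf wfX closed in auto)
  moreover have "wf_digraph (with_proj (disj_union (induced X C) (induced X (- C))))"
    by (simp add: wf_digraph_wp_iff wf pair_wf_disj_union)
  ultimately show ?thesis by (simp add: digraph_iso_swap)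
qed

text \<open>
  The working form of uniqueness: once the partner \<open>z\<close> of \<open>u\<close> is known, any other walk of
  length \<open>2\<close> from \<open>u\<close> ends at \<open>u\<close> or at a neighbour of \<open>u\<close>.
\<close>

lemma two_steps_cases:
  assumes wf: "pair_wf_digraph X"
    and reg: "one_regular (T2 X)"
    and arcs: "(u, v) \<in> parcs X" "(v, w) \<in> parcs X" and z: "(u, z) \<in> parcs (T2 X)"
  shows "w = u \<or> w = z \<or> (u, w) \<in> parcs X"
proof (rule ccontr)
  assume "\<not> ?thesis"
  then have "u \<noteq> w" "w \<noteq> z" "(u, w) \<notin> parcs X" by blast+
  with arcs have "(u, w) \<in> parcs (T2 X)" using parcs_T2[OF wf, of u w] by blast
  moreover from z have "u \<in> pverts (T2 X)" by (simp add: T2_def)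
  ultimately show False using reg z \<open>w \<noteq> z\<close> unfolding one_regular_def by blast
qed

text \<open>
  The assumptions say that \<open>a\<close> and \<open>d\<close> are at distance \<open>3\<close>. A shorter connection between \<open>a\<close>
  and \<open>c\<close> or between \<open>b\<close> and \<open>d\<close> would also shorten the path from \<open>a\<close> to \<open>d\<close>.
\<close>

lemma geodesic_T2:
  assumes X: "pair_graph X"
    and path: "(a, b) \<in> parcs X" "(b, c) \<in> parcs X" "(c, d) \<in> parcs X"
    and far: "a \<noteq> d" "(a, d) \<notin> parcs X" "\<forall>x. (a, x) \<in> parcs X \<longrightarrow> (x, d) \<notin> parcs X"
  shows "(a, c) \<in> parcs (T2 X)" "(c, a) \<in> parcs (T2 X)"
    and "(b, d) \<in> parcs (T2 X)" "(d, b) \<in> parcs (T2 X)"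
proof -
  interpret pair_graph X by fact
  note rev = path[THEN arcs_symmetric]
  have ne: "a \<noteq> c" "b \<noteq> d" using path far(2) by blast+
  have na: "(a, c) \<notin> parcs X" "(b, d) \<notin> parcs X" using path far(3) by blast+
  then have na': "(c, a) \<notin> parcs X" "(d, b) \<notin> parcs X" using arcs_symmetric by blast+
  note T2 = parcs_T2[OF pair_wf_digraph]
  show "(a, c) \<in> parcs (T2 X)" using T2[of a c] ne(1) na(1) path(1,2) by blast
  show "(c, a) \<in> parcs (T2 X)" using T2[of c a] ne(1) na'(1) rev(1,2) by blast
  show "(b, d) \<in> parcs (T2 X)" using T2[of b d] ne(2) na(2) path(2,3) by blast
  show "(d, b) \<in> parcs (T2 X)" using T2[of d b] ne(2) na'(2) rev(2,3) by blast
qed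

text \<open>
  If \<open>e\<close> were outside the path, adjacency to \<open>e\<close> would pass from \<open>a\<close> to \<open>b\<close>, \<open>c\<close> and \<open>d\<close> in
  turn, each time because the partner of the next vertex lies on the path and so is not \<open>e\<close>. In
  the end \<open>e\<close> would be a common neighbour of \<open>a\<close> and \<open>d\<close>.
\<close>

lemma geodesic_end:
  assumes X: "pair_graph X"
    and reg: "one_regular (T2 X)"
    and path: "(a, b) \<in> parcs X" "(b, c) \<in> parcs X" "(c, d) \<in> parcs X"
    and far: "a \<noteq> d" "(a, d) \<notin> parcs X" "\<forall>x. (a, x) \<in> parcs X \<longrightarrow> (x, d) \<notin> parcs X"
    and e: "(a, e) \<in> parcs X"
  shows "e \<in> {a, b, c, d}"
proof (rule ccontr)
  assume "e \<notin> {a, b, c, d}"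
  then have ne: "e \<noteq> a" "e \<noteq> b" "e \<noteq> c" "e \<noteq> d" by auto
  interpret pair_graph X by fact
  note rev = path[THEN arcs_symmetric]
  note step = two_steps_cases[OF pair_wf_digraph reg]
  note T2 = geodesic_T2[OF X path far]
  have "(b, e) \<in> parcs X" using step[OF rev(1) e T2(3)] ne by blast
  then have "(c, e) \<in> parcs X" using step[OF rev(2) _ T2(2)] ne by blast
  then have "(d, e) \<in> parcs X" using step[OF rev(3) _ T2(4)] ne by blast
  then show False using far(3) e arcs_symmetric[of d e] by blast
qed

text \<open>
  Neighbours of the ends are covered by the previous lemma, applied to the path and to its
  reverse. A neighbour of \<open>b\<close> other than \<open>a\<close> and \<open>c\<close> is adjacent to \<open>a\<close>, since \<open>c\<close> is the
  partner of \<open>a\<close>; this reduces inner vertices to ends.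
\<close>

lemma geodesic_component:
  assumes X: "pair_graph X"
    and reg: "one_regular (T2 X)"
    and path: "(a, b) \<in> parcs X" "(b, c) \<in> parcs X" "(c, d) \<in> parcs X"
    and far: "a \<noteq> d" "(a, d) \<notin> parcs X" "\<forall>x. (a, x) \<in> parcs X \<longrightarrow> (x, d) \<notin> parcs X"
  shows "\<And>u v. (u, v) \<in> parcs X \<Longrightarrow> u \<in> {a, b, c, d} \<longleftrightarrow> v \<in> {a, b, c, d}"
    and "induced X {a, b, c, d} \<simeq> path_graph 4"
proof -
  interpret pair_graph X by fact
  note rev = path[THEN arcs_symmetric]
  note step = two_steps_cases[OF pair_wf_digraph reg]
  note T2 = geodesic_T2[OF X path far]
  have a: "v \<in> {a, b, c, d}" if "(a, v) \<in> parcs X" for v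
    using geodesic_end[OF X reg path far that] .
  have "v \<in> {d, c, b, a}" if "(d, v) \<in> parcs X" for v
  proof (rule geodesic_end[OF X reg rev(3,2,1) _ _ _ that])
    show "d \<noteq> a" using far(1) by blast
    show "(d, a) \<notin> parcs X" using far(2) arcs_symmetric[of d a] by blast
    show "\<forall>x. (d, x) \<in> parcs X \<longrightarrow> (x, a) \<notin> parcs X"
      using far(3) arcs_symmetric by blast
  qed
  then have d: "v \<in> {a, b, c, d}" if "(d, v) \<in> parcs X" for v
    using that by blast
  have b: "v \<in> {a, b, c, d}" if "(b, v) \<in> parcs X" for v
    using step[OF path(1) that T2(1)] a[of v] by blast
  have c: "v \<in> {a, b, c, d}" if "(c, v) \<in> parcs X" for v
    using step[OF rev(3) that T2(4)] d[of v] by blast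
  have out: "v \<in> {a, b, c, d}" if "(u, v) \<in> parcs X" "u \<in> {a, b, c, d}" for u v
    using that a[of v] b[of v] c[of v] d[of v] by blast
  show "u \<in> {a, b, c, d} \<longleftrightarrow> v \<in> {a, b, c, d}" if "(u, v) \<in> parcs X" for u v
    using out[of u v] out[of v u] that arcs_symmetric[of u v] by blast
  have nonadj: "(a, c) \<notin> parcs X" "(c, a) \<notin> parcs X" "(b, d) \<notin> parcs X" "(d, b) \<notin> parcs X"
    and "a \<noteq> c" "b \<noteq> d"
    using T2 unfolding parcs_T2[OF pair_wf_digraph] by blast+
  then have ne: "a \<noteq> b" "a \<noteq> c" "a \<noteq> d" "b \<noteq> c" "b \<noteq> d" "c \<noteq> d"
    using path[THEN no_loops'] far(1) by blast+
  have da: "(d, a) \<notin> parcs X" using far(2) arcs_symmetric[of d a] by blast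
  have V: "a \<in> pverts X" "b \<in> pverts X" "c \<in> pverts X" "d \<in> pverts X"
    using path wellformed' by blast+
  have loop: "(u, u) \<notin> parcs X" for u using no_loops' by blast
  let ?f = "\<lambda>x. if x = a then 1 else if x = b then 2 else if x = c then 3 else 4 :: nat"
  show "induced X {a, b, c, d} \<simeq> path_graph 4"
  proof (rule pair_isoI[where f = ?f])
    show "pair_wf_digraph (induced X {a, b, c, d})"
      using pair_graph_induced[OF X] by (rule pair_graph_imp_wf)
    have "pverts (induced X {a, b, c, d}) = {a, b, c, d}" using V by auto
    then show "bij_betw ?f (pverts (induced X {a, b, c, d})) (pverts (path_graph 4))"
      using ne by (simp add: bij_betw_def path_graph_4 insert_commute)
    fix u v assume "u \<in> pverts (induced X {a, b, c, d})" "v \<in> pverts (induced X {a, b, c, d})"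
    then have "u \<in> {a, b, c, d}" "v \<in> {a, b, c, d}" by auto
    then show "(u, v) \<in> parcs (induced X {a, b, c, d}) \<longleftrightarrow> (?f u, ?f v) \<in> parcs (path_graph 4)"
      unfolding insert_iff empty_iff
      by (elim disjE) (simp_all add: path_graph_4 path rev nonadj da far(2) ne ne[symmetric] loop)
  qed (rule pair_wf_path_graph)
qed

text \<open>
  If no two vertices are at distance \<open>3\<close>, the vertices that are equal to \<open>u\<close>, adjacent to \<open>u\<close> or
  the partner \<open>s u\<close> of \<open>u\<close> (relation \<open>near\<close>) are all the vertices reachable from \<open>u\<close>: a step
  from \<open>s u\<close> to \<open>z\<close> makes a walk of length \<open>3\<close> from \<open>u\<close> to \<open>z\<close>, which can be shortened.
\<close>

lemma ex_component:
  assumes X: "pair_graph X" and reg: "one_regular (T2 X)" and v0: "v0 \<in> pverts X"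
  obtains C where "C \<subseteq> pverts X" "C \<noteq> {}"
    and "\<forall>u v. (u, v) \<in> parcs X \<longrightarrow> (u \<in> C \<longleftrightarrow> v \<in> C)"
    and "induced X C \<simeq> path_graph 4 \<or> (\<exists>n\<ge>2. induced X C \<simeq> cocktail_party n)"
proof -
  interpret pair_graph X by fact
  from reg obtain s where "\<forall>v\<in>pverts (T2 X). \<forall>w. (v, w) \<in> parcs (T2 X) \<longleftrightarrow> w = s v"
    by (rule one_regular_partner)
  then have s: "(v, w) \<in> parcs (T2 X) \<longleftrightarrow> w = s v" if "v \<in> pverts X" for v w
    using that unfolding pverts_T2 by blast
  note T2 = parcs_T2[OF pair_wf_digraph]
  have T2V: "u \<in> pverts X \<and> v \<in> pverts X" if "(u, v) \<in> parcs (T2 X)" for u v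
    using that by (simp add: T2_def)
  show thesis
  proof (cases "\<exists>a b c d. (a, b) \<in> parcs X \<and> (b, c) \<in> parcs X \<and> (c, d) \<in> parcs X \<and>
      a \<noteq> d \<and> (a, d) \<notin> parcs X \<and> (\<forall>x. (a, x) \<in> parcs X \<longrightarrow> (x, d) \<notin> parcs X)")
    case True
    then obtain a b c d where path: "(a, b) \<in> parcs X" "(b, c) \<in> parcs X" "(c, d) \<in> parcs X"
      and far: "a \<noteq> d" "(a, d) \<notin> parcs X" "\<forall>x. (a, x) \<in> parcs X \<longrightarrow> (x, d) \<notin> parcs X"
      by blast
    show thesis
    proof (rule that)
      show "{a, b, c, d} \<subseteq> pverts X" using path wellformed' by blast
      show "\<forall>u v. (u, v) \<in> parcs X \<longrightarrow> (u \<in> {a, b, c, d} \<longleftrightarrow> v \<in> {a, b, c, d})"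
        using geodesic_component(1)[OF X reg path far] by blast
      show "induced X {a, b, c, d} \<simeq> path_graph 4 \<or>
          (\<exists>n\<ge>2. induced X {a, b, c, d} \<simeq> cocktail_party n)"
        using geodesic_component(2)[OF X reg path far] by blast
    qed simp
  next
    case False
    define near where "near u w \<longleftrightarrow> u = w \<or> (u, w) \<in> parcs X \<or> w = s u" for u w
    have s_inv: "s u \<in> pverts X \<and> s (s u) = u \<and> s u \<noteq> u \<and> (u, s u) \<notin> parcs X"
      and s_mid: "\<exists>x. (u, x) \<in> parcs X \<and> (x, s u) \<in> parcs X" if u: "u \<in> pverts X" for u
    proof -
      have us: "(u, s u) \<in> parcs (T2 X)" using s[OF u] by blast
      then obtain x where x: "(u, x) \<in> parcs X" "(x, s u) \<in> parcs X"
        and ne: "u \<noteq> s u" and na: "(u, s u) \<notin> parcs X"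
        unfolding T2 by blast
      then show "\<exists>x. (u, x) \<in> parcs X \<and> (x, s u) \<in> parcs X" by blast
      have na': "(s u, u) \<notin> parcs X" using na arcs_symmetric[of "s u" u] by blast
      have "(s u, u) \<in> parcs (T2 X)"
        using T2[of "s u" u] ne[symmetric] na' x[THEN arcs_symmetric] by blast
      moreover have "s u \<in> pverts X" using T2V[OF us] by blast
      ultimately have "u = s (s u)" using s[of "s u" u] by blast
      then show "s u \<in> pverts X \<and> s (s u) = u \<and> s u \<noteq> u \<and> (u, s u) \<notin> parcs X"
        using \<open>s u \<in> pverts X\<close> ne na by metis
    qed
    have two_steps: "near u z" if "(u, w) \<in> parcs X" "(w, z) \<in> parcs X" for u w z
      using that s[of u z] T2[of u z] wellformed'(1)[of u w] unfolding near_def by blast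
    have near_step: "near u z" if u: "u \<in> pverts X" and uw: "near u w" and wz: "(w, z) \<in> parcs X" for u w z
    proof -
      consider "u = w" | "(u, w) \<in> parcs X" | "w = s u" using uw unfolding near_def by blast
      then show ?thesis
      proof cases
        case 1
        then show ?thesis using wz by (simp add: near_def)
      next
        case 2
        then show ?thesis using wz by (rule two_steps)
      next
        case 3
        then obtain x where "(u, x) \<in> parcs X" "(x, w) \<in> parcs X" using s_mid[OF u] by blast
        then have "u = z \<or> (u, z) \<in> parcs X \<or> (\<exists>y. (u, y) \<in> parcs X \<and> (y, z) \<in> parcs X)"
          using False wz by blast
        then show ?thesis using two_steps[of u _ z] unfolding near_def by blast
      qed
    qed
    have near_s: "near u (s w)" if u: "u \<in> pverts X" and w: "w \<in> pverts X" and uw: "near u w" for u w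
    proof -
      obtain x where x: "(w, x) \<in> parcs X" "(x, s w) \<in> parcs X" using s_mid[OF w] by blast
      have "near u x" using u uw x(1) by (rule near_step)
      with u show ?thesis using x(2) by (rule near_step)
    qed
    have near_sym: "near w u" if "u \<in> pverts X" "near u w" for u w
      using that(2) s_inv[OF that(1)] arcs_symmetric[of u w] unfolding near_def by metis
    have near_trans: "near u z"
      if u: "u \<in> pverts X" and w: "w \<in> pverts X" and uw: "near u w" and wz: "near w z" for u w z
    proof -
      consider "z = w" | "(w, z) \<in> parcs X" | "z = s w" using wz unfolding near_def by blast
      then show ?thesis
        using uw near_step[OF u uw, of z] near_s[OF u w uw] by cases simp_all
    qed
    define C where "C = {w \<in> pverts X. near v0 w}"
    have C_V: "C \<subseteq> pverts X" and v0C: "v0 \<in> C"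
      using v0 by (auto simp: C_def near_def)
    have C_near: "near u w" if "u \<in> C" "w \<in> C" for u w
    proof -
      have u: "u \<in> pverts X" "near v0 u" and w: "near v0 w" using that by (simp_all add: C_def)
      show ?thesis using u(1) v0 near_sym[OF v0 u(2)] w by (rule near_trans)
    qed
    have C_s: "s u \<in> C" if "u \<in> C" for u
      using that near_s[OF v0, of u] s_inv[of u] by (simp add: C_def)
    have C_arc: "v \<in> C" if "u \<in> C" "(u, v) \<in> parcs X" for u v
      using that near_step[OF v0, of u v] wellformed'(2)[of u v] by (simp add: C_def)
    have adj: "(u, w) \<in> parcs X \<longleftrightarrow> u \<noteq> w \<and> w \<noteq> s u" if "u \<in> C" "w \<in> C" for u w
    proof -
      have "u \<in> pverts X" using that C_V by blast
      then show ?thesis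
        using C_near[OF that] s_inv[of u] no_loops'[of u w] unfolding near_def by blast
    qed
    have fin: "finite C" using C_V pair_finite_verts by (rule finite_subset)
    have s_C: "\<forall>u\<in>C. s u \<in> C \<and> s (s u) = u \<and> s u \<noteq> u"
    proof
      fix u assume u: "u \<in> C"
      then have "u \<in> pverts X" using C_V by blast
      then show "s u \<in> C \<and> s (s u) = u \<and> s u \<noteq> u" using C_s[OF u] s_inv[of u] by simp
    qed
    from involution_enumeration[OF fin s_C]
    obtain n and g :: "'a \<Rightarrow> nat + nat" where g: "bij_betw g C (Inl ` {1..n} \<union> Inr ` {1..n})"
      and gs: "\<forall>x\<in>C. g (s x) = case_sum Inr Inl (g x)"
      by blast
    have cardC: "card C = 2 * n"
      using bij_betw_same_card[OF g] card_cocktail_party(2)[of n] by (simp add: pverts_cocktail_party)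
    \<comment> \<open>A vertex, its partner and a common neighbour of the two are three vertices, and the order
      is even.\<close>
    have "n \<ge> 2"
    proof -
      obtain x where x: "(v0, x) \<in> parcs X" "(x, s v0) \<in> parcs X" using s_mid[OF v0] by blast
      have sub: "{v0, x, s v0} \<subseteq> C" using v0C C_s[OF v0C] C_arc[OF v0C x(1)] by simp
      have "v0 \<noteq> x" "x \<noteq> s v0" "v0 \<noteq> s v0"
        using x[THEN no_loops'] s_inv[OF v0] by metis+
      then have "card {v0, x, s v0} = 3" by simp
      then have "3 \<le> card C" using card_mono[OF fin sub] by simp
      then show ?thesis using cardC by simp
    qed
    moreover have "induced X C \<simeq> cocktail_party n"
    proof (rule pair_isoI[where f = g])
      show "pair_wf_digraph (induced X C)"
        using pair_graph_induced[OF X] by (rule pair_graph_imp_wf)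
      show "bij_betw g (pverts (induced X C)) (pverts (cocktail_party n))"
        using g C_V by (simp add: pverts_cocktail_party Int_absorb1)
    next
      fix u v assume "u \<in> pverts (induced X C)" "v \<in> pverts (induced X C)"
      then have uv: "u \<in> C" "v \<in> C" by auto
      have inj: "g x = g y \<longleftrightarrow> x = y" if "x \<in> C" "y \<in> C" for x y
        using bij_betw_imp_inj_on[OF g] that by (rule inj_on_eq_iff)
      have gV: "g x \<in> pverts (cocktail_party n)" if "x \<in> C" for x
        using bij_betwE[OF g] that by (simp add: pverts_cocktail_party)
      show "(u, v) \<in> parcs (induced X C) \<longleftrightarrow> (g u, g v) \<in> parcs (cocktail_party n)"
        unfolding parcs_cocktail_party gs[rule_format, OF uv(1), symmetric]
        by (simp only: parcs_induced uv adj[OF uv] inj[OF uv] inj[OF uv(2) C_s[OF uv(1)]]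
            gV[OF uv(1)] gV[OF uv(2)] simp_thms)
    qed (rule pair_wf_cocktail_party)
    moreover have "u \<in> C \<longleftrightarrow> v \<in> C" if "(u, v) \<in> parcs X" for u v
      using C_arc[of u v] C_arc[of v u] that arcs_symmetric[OF that] by blast
    ultimately show thesis using that[of C] C_V v0C by blast
  qed
qed

text \<open>
  Letting \<open>N\<close> be the same set \<open>{2..M}\<close> for all graphs with at most \<open>M\<close> vertices keeps it
  constant in the induction, so that attaching a cocktail party graph only increments one
  multiplicity.
\<close>

lemma decomposition:
  assumes "pair_graph X" "one_regular (T2 X)" "card (pverts X) \<le> M"
  shows "\<exists>p q. X \<simeq> P4_CP_union p {2..M} q"
  using assms
proof (induction "card (pverts X)" arbitrary: X rule: less_induct)
  case less
  note X = \<open>pair_graph X\<close>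
  interpret pair_graph X by fact
  have wf: "pair_wf_digraph (induced X S)" for S
    using pair_graph_induced[OF X] by (rule pair_graph_imp_wf)
  show ?case
  proof (cases "pverts X = {}")
    case True
    have "pverts (P4_CP_union 0 {2..M} (\<lambda>_. 0)) = {}"
      by (auto simp: copies_def disj_Union_def)
    then have "X \<simeq> P4_CP_union 0 {2..M} (\<lambda>_. 0)"
      using True by (intro pair_isoI[where f = "\<lambda>_. Inl (0, 0)"])
        (auto simp del: pverts_disj_union simp: bij_betw_def
          intro: pair_wf_digraph pair_wf_P4_CP_union)
    then show ?thesis by (intro exI)
  next
    case False
    then obtain v0 where "v0 \<in> pverts X" by blast
    with X less.prems(2) obtain C where C: "C \<subseteq> pverts X" "C \<noteq> {}"
      and closed: "\<forall>u v. (u, v) \<in> parcs X \<longrightarrow> (u \<in> C \<longleftrightarrow> v \<in> C)"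
      and type: "induced X C \<simeq> path_graph 4 \<or> (\<exists>n\<ge>2. induced X C \<simeq> cocktail_party n)"
      by (rule ex_component)
    let ?K = "induced X C" and ?H = "induced X (- C)"
    have iso: "X \<simeq> disj_union ?K ?H"
      by (rule iso_disj_union_induced[OF X]) (use closed in blast)
    have "T2 X \<simeq> T2 (disj_union ?K ?H)"
      by (intro T2_cong iso pair_wf_digraph pair_wf_disj_union wf)
    then have "T2 (disj_union ?K ?H) \<simeq> T2 X"
      by (rule digraph_iso_swap[rotated]) (simp add: wf_digraph_wp_iff pair_wf_T2)
    then have "one_regular (T2 (disj_union ?K ?H))"
      by (rule one_regular_iso[OF pair_wf_T2 pair_wf_T2 _ less.prems(2)])
    then have reg: "one_regular (T2 ?H)"
      by (simp add: T2_disj_union[OF wf wf] one_regular_disj_union)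
    have "pverts ?H \<subset> pverts X" using C by auto
    then have lt: "card (pverts ?H) < card (pverts X)"
      by (rule psubset_card_mono[OF pair_finite_verts])
    then have "card (pverts ?H) \<le> M" using less.prems(3) by linarith
    then obtain p q where H: "?H \<simeq> P4_CP_union p {2..M} q"
      using less.hyps[OF lt pair_graph_induced[OF X] reg] by blast
    note attach = digraph_iso_trans[OF iso disj_union_cong[OF _ H wf _ wf pair_wf_P4_CP_union]]
    from type show ?thesis
    proof
      assume "?K \<simeq> path_graph 4"
      then have "X \<simeq> P4_CP_union (Suc p) {2..M} q"
        by (rule digraph_iso_trans[OF attach[OF _ pair_wf_path_graph] add_P4])
      then show ?thesis by blast
    next
      assume "\<exists>n\<ge>2. ?K \<simeq> cocktail_party n"
      then obtain n where n: "n \<ge> 2" and K: "?K \<simeq> cocktail_party n" by blast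
      have "2 * n = card C"
        using pair_iso_card[OF K] C(1) by (simp add: card_cocktail_party Int_absorb1)
      also have "\<dots> \<le> M"
        using card_mono[OF pair_finite_verts C(1)] less.prems(3) by simp
      finally have nM: "n \<in> {2..M}" using n by simp
      have "X \<simeq> P4_CP_union p {2..M} (q(n := Suc (q n)))"
        by (rule digraph_iso_trans[OF attach[OF K pair_wf_cocktail_party] add_CP[OF nM]])
      then show ?thesis by blast
    qed
  qed
qed

theorem corollary3p2:
  fixes X :: "'a pair_pre_digraph" and k :: nat
  assumes "k \<ge> 2" and "pair_graph X"
  shows "digraph_iso (with_proj (T2 X)) (with_proj (copies k (path_graph 2)))
    \<longleftrightarrow> (\<exists>(p::nat) (N::nat set) (q::nat \<Rightarrow> nat).
          finite N \<and> (\<forall>n\<in>N. n \<ge> 2) \<and> 2 * p + (\<Sum>n\<in>N. q n * n) = k \<and>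
          digraph_iso (with_proj X)
            (with_proj (disj_union (copies p (path_graph 4))
                          (disj_Union N (\<lambda>n. copies (q n) (cocktail_party n))))))"
proof -
  interpret pair_graph X by fact
  have kP2: "pair_wf_digraph (copies k (path_graph 2))" "one_regular (copies k (path_graph 2))"
    by (simp_all add: pair_wf_copies pair_wf_path_graph one_regular_P2 one_regular_disj_Union
        copies_def[of k "path_graph 2"] pair_wf_disj_Union)
  show ?thesis
  proof
    assume iso: "T2 X \<simeq> copies k (path_graph 2)"
    then have "one_regular (T2 X)" using one_regular_iso kP2 pair_wf_T2 by blast
    then obtain p q where X: "X \<simeq> P4_CP_union p {2..card (pverts X)} q"
      using decomposition[of X "card (pverts X)"] assms(2) by blast
    have "card (pverts X) = 2 * k"
      using pair_iso_card[OF iso] by (simp add: card_copies card_path_graph)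
    then have "2 * p + (\<Sum>n\<in>{2..card (pverts X)}. q n * n) = k"
      using pair_iso_card[OF X] card_P4_CP_union[of "{2..card (pverts X)}" p q] by simp
    then show "\<exists>p N q. finite N \<and> (\<forall>n\<in>N. n \<ge> 2) \<and> 2 * p + (\<Sum>n\<in>N. q n * n) = k \<and>
        X \<simeq> P4_CP_union p N q"
      using X by (intro exI[of _ p] exI[of _ "{2..card (pverts X)}"] exI[of _ q]) simp
  next
    assume "\<exists>p N q. finite N \<and> (\<forall>n\<in>N. n \<ge> 2) \<and> 2 * p + (\<Sum>n\<in>N. q n * n) = k \<and>
        X \<simeq> P4_CP_union p N q"
    then obtain p N q where N: "finite N" "\<forall>n\<in>N. n \<ge> 2" and k: "2 * p + (\<Sum>n\<in>N. q n * n) = k"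
      and X: "X \<simeq> P4_CP_union p N q" by blast
    have "one_regular (T2 X)"
      by (rule one_regular_iso[OF pair_wf_T2 pair_wf_T2 T2_cong one_regular_T2_P4_CP_union])
        (fact pair_wf_digraph pair_wf_P4_CP_union X N)+
    moreover have "card (pverts (T2 X)) = 2 * k"
      using pair_iso_card[OF X] card_P4_CP_union[OF N(1)] k by simp
    moreover have "(v, u) \<in> parcs (T2 X) \<and> u \<noteq> v" if "(u, v) \<in> parcs (T2 X)" for u v
      using that arcs_symmetric unfolding parcs_T2[OF pair_wf_digraph] by blast
    ultimately show "T2 X \<simeq> copies k (path_graph 2)"
      by (intro one_regular_iso_kP2) (simp_all add: pair_wf_T2 pair_finite_verts)
  qed
qed

end
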